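(* Let $\zeta$ be the Riemann zeta function. For all real $\sigma\ge2$ and all real $t$, $$|\zeta(\sigma+it)|<2.$$ *)

theory Defs
  imports "HOL-Complex_Analysis.Complex_Analysis"
begin

definition zeta_series :: "complex \<Rightarrow> complex" where
  "zeta_series s = (\<Sum>n. 1 / of_nat (Suc n) powr s)"

(* The continuation is determined by the identity theorem on - {1}; the value at the
   pole s = 1 is left unspecified. *)
definition zeta :: "complex \<Rightarrow> complex" where
  "zeta s =
     (if Re s > 1 then zeta_series s
      else (SOME f. f holomorphic_on - {1} \<and> (\<forall>z. Re z > 1 \<longrightarrow> f z = zeta_series z)) s)"

end

theory Submission
  imports Defs "HOL-Real_Asymp.Real_Asymp"
begin

text \<open>Since $\sigma \ge 2$, the $n$-th term has modulus at most
  $1/n^2 < 1/(n^2 - 1/4) = 1/(n - 1/2) - 1/(n + 1/2)$, and the last expression telescopes to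
  exactly $2$ when summed over $n \ge 1$.\<close>

lemma telescope_half_sums:
  "(\<lambda>n. 1 / (real n + 1/2) - 1 / (real (Suc n) + 1/2)) sums 2"
proof -
  have "(\<lambda>n. 1 / (real n + 1/2)) \<longlonglongrightarrow> 0"
    by real_asymp
  \<comment> \<open>The sum is the value at \<open>n = 0\<close>, namely 1/(1/2) = 2, minus the
    limit 0.\<close>
  from telescope_sums'[OF this] show ?thesis by simp
qed

lemma inverse_square_less_telescope:
  "1 / (real (Suc n))\<^sup>2 < 1 / (real n + 1/2) - 1 / (real (Suc n) + 1/2)"
proof -
  \<comment> \<open>With m = \<open>Suc n\<close> the product is (m - 1/2)(m + 1/2) = m^2 -
    1/4.\<close>
  have "1 / (real (Suc n))\<^sup>2 < 1 / ((real n + 1/2) * (real (Suc n) + 1/2))"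
    by (rule frac_less2) (auto simp: power2_eq_square algebra_simps intro!: add_nonneg_pos)
  also have "\<dots> = 1 / (real n + 1/2) - 1 / (real (Suc n) + 1/2)"
    by (subst diff_frac_eq) auto
  finally show ?thesis .
qed

text \<open>For a positive real base the modulus of the power depends only on \<open>Re s\<close>,
  and for a base at least 1 it grows with that exponent.\<close>

lemma norm_zeta_term_le:
  assumes "Re s \<ge> 2"
  shows "cmod (1 / of_nat (Suc n) powr s) \<le> 1 / (real (Suc n))\<^sup>2"
proof -
  have "cmod (of_nat (Suc n) powr s) = real (Suc n) powr Re s"
    using norm_powr_real_powr[of "of_nat (Suc n)" s] by (simp del: of_nat_Suc)
  moreover have "(real (Suc n))\<^sup>2 \<le> real (Suc n) powr Re s"
    using powr_mono[OF assms, of "real (Suc n)"] by (simp add: powr_numeral del: of_nat_Suc)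
  ultimately show ?thesis
    by (simp add: norm_divide frac_le del: of_nat_Suc)
qed

lemma norm_zeta_series_less_2:
  assumes "Re s \<ge> 2"
  shows "cmod (zeta_series s) < 2"
proof -
  define f where "f = (\<lambda>n. cmod (1 / of_nat (Suc n) powr s))"
  define g where "g = (\<lambda>n. 1 / (real n + 1/2) - 1 / (real (Suc n) + 1/2))"
  have g: "g sums 2"
    unfolding g_def by (rule telescope_half_sums)
  have less: "f n < g n" for n
    unfolding f_def g_def
    using norm_zeta_term_le[OF assms] inverse_square_less_telescope by (rule le_less_trans)
  have f: "summable f"
    by (rule summable_comparison_test'[OF sums_summable[OF g], of 0])
       (use less in \<open>auto simp: f_def intro: less_imp_le\<close>)
  \<comment> \<open>Summing the termwise bounds as limits of partial sums would only give a weak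
    inequality. Strictness survives because a convergent series of positive terms has a positive
    sum.\<close>
  have "0 < (\<Sum>n. g n - f n)"
    by (rule suminf_pos) (use less f g in \<open>auto intro: summable_diff sums_summable\<close>)
  also have "\<dots> = 2 - suminf f"
    using suminf_diff[OF sums_summable[OF g] f] sums_unique[OF g] by simp
  finally have "suminf f < 2" by simp
  moreover have "cmod (zeta_series s) \<le> suminf f"
    using summable_norm[of "\<lambda>n. 1 / of_nat (Suc n) powr s"] f
    unfolding zeta_series_def f_def by blast
  ultimately show ?thesis by linarith
qed

theorem proposition6:
  fixes \<sigma> t :: real
  assumes "\<sigma> \<ge> 2"
  shows "cmod (zeta (of_real \<sigma> + \<i> * of_real t)) < 2"
  \<comment> \<open>The real part is \<sigma> > 1, so \<open>zeta\<close> is given by its series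
    here.\<close>
  using norm_zeta_series_less_2[of "of_real \<sigma> + \<i> * of_real t"] assms
  by (simp add: zeta_def)

end
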